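(* Let $(M,\omega)$ be a symplectic manifold, $\nabla$ a torsion-free symplectic connection on $M$, $L\to M$ a complex line bundle with connection $\nabla^L$, and $\Omega=\sum_{i\ge1}\lambda^i\Omega_i$ a formal series of closed two-forms on $M$. Let $\star$ be the Fedosov star product on $C^\infty(M)[[\lambda]]$ built from $\nabla$ and $\Omega$, and let $\star'$ be the Fedosov product on $\Gamma^\infty(\mathrm{End}(L))[[\lambda]]=C^\infty(M)[[\lambda]]$ built from $\nabla$, $\nabla^L$ and the same $\Omega$ (which is also a star product on $M$). Then their characteristic classes are related by $$c(\star')=c(\star)+2\pi\mathrm i\,c_1(L),$$ where $c_1(L)\in H^2_{\mathrm{dR}}(M)$ is the first Chern class of $L$.
   Context: Spaces (all bundles complexified, $\lambda$ a formal parameter): $\mathcal W=\prod_{s\ge0}\Gamma^\infty(\bigvee^sT^*M)[[\lambda]]$, $\mathcal W\otimes\Lambda^\bullet=\prod_s\Gamma^\infty(\bigvee^sT^*M\otimes\bigwedge^\bullet T^*M)[[\lambda]]$. For a line bundle $L$, $\mathrm{End}(L)$ is canonically the trivial line bundle with the trivial induced connection, so $\mathcal W\otimes\Lambda^\bullet\otimes\mathcal End(\mathcal L)=\mathcal W\otimes\Lambda^\bullet$ and $D'=D$ below. Degrees: $\deg_s,\deg_a,\deg_\lambda$ are the symmetric, antisymmetric and $\lambda$-degree; the total degree is $\mathrm{Deg}=2\deg_\lambda+\deg_s$. $\ker\deg_a$ means the elements of antisymmetric degree $0$. $\sigma$ is the projection onto the part of symmetric and antisymmetric degree $0$. Operators: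 $\delta=(1\otimes dx^i)\,i_s(\partial_i)$ and $\delta^*=(dx^i\otimes1)\,i_a(\partial_i)$, with $i_s,i_a$ the symmetric and antisymmetric insertions (in $\delta$ the form $dx^i$ multiplies in the $\bigwedge$ factor, in $\delta^*$ in the $\bigvee$ factor). $\delta^{-1}a=\frac1{k+l}\delta^*a$ if $\deg_sa=ka$, $\deg_aa=la$ with $k+l\neq0$, and $\delta^{-1}a=0$ if $k=l=0$. $D=(1\otimes dx^i)\nabla_{\partial_i}$. Fiberwise Weyl product: $f\circ g=\mu\circ e^{\frac{\mathrm i\lambda}{2}\Lambda^{kl}i_s(\partial_k)\otimes i_s(\partial_l)}(f\otimes g)$ for $f,g\in\mathcal W$, with $\mu$ the symmetric product and $\Lambda^{kl}=-\omega^{kl}$ the Poisson tensor ($\omega^{kl}$ the inverse matrix of $\omega_{kl}$, where $\omega=\frac12\omega_{kl}dx^k\wedge dx^l$), extended to $\mathcal W\otimes\Lambda^\bullet$ by $\wedge$ on forms; $\mathrm{ad}$ is the super-commutator (graded by $\deg_a$) with respect to $\circ$. Expressions with $1/\lambda$ are understood after allowing negative powers of $\lambda$. Curvatures: $R=\frac14\omega_{lm}R^m_{kij}\,dx^l\vee dx^k\otimes dx^i\wedge dx^j$ with $R(\partial_i,\partial_j)\partial_k=R^m_{kij}\partial_m$ the curvature of $\nabla$; $R^L=\frac12dx^i\wedge dx^j\,R^L_{ij}$ is the curvature two-form of $\nabla^L$. The Chern class is $c_1(L)=[\frac{\mathrm i}{2\pi}R^L]$. Fedosov construction: by Fedosov's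 theorem there are unique $r,r'\in\mathcal W\otimes\Lambda^1$ of total degree $\ge3$ with $\delta r=R+Dr+\frac{\mathrm i}{\lambda}r\circ r+\Omega$, $\delta^{-1}r=0$, and $\delta r'=R-\mathrm i\lambda R^L+D'r'+\frac{\mathrm i}{\lambda}r'\circ r'+\Omega$, $\delta^{-1}r'=0$. Put $\mathcal D=-\delta+D+\frac{\mathrm i}{\lambda}\mathrm{ad}(r)$ and $\mathcal D'=-\delta+D'+\frac{\mathrm i}{\lambda}\mathrm{ad}(r')$. Then $\sigma$ restricts to bijections from $\ker\mathcal D\cap\ker\deg_a$ and from $\ker\mathcal D'\cap\ker\deg_a$ onto $C^\infty(M)[[\lambda]]$, with inverses $\tau$ and $\tau'$, and $f\star g=\sigma(\tau(f)\circ\tau(g))$, $f\star'g=\sigma(\tau'(f)\circ\tau'(g))$. Classes: for a Fedosov star product $\star$ obtained from a Fedosov derivative $-\delta+D+\frac{\mathrm i}{\lambda}\mathrm{ad}(r)$, its Fedosov class is the de Rham class $F(\star)=[\omega+\delta r-R-Dr-\frac{\mathrm i}{\lambda}r\circ r]\in H^2_{\mathrm{dR}}(M;\mathbb C)[[\lambda]]$, and its characteristic class is $c(\star)=\frac{1}{\mathrm i\lambda}F(\star)$. The same definitions, with $r'$ in place of $r$, apply to $\star'$. *)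

theory Defs
  imports
    "HOL-Analysis.Analysis"
    "HOL-Library.Function_Algebras"
    "HOL-Library.Set_Algebras"
    "HOL-Computational_Algebra.Formal_Laurent_Series"
begin

section \<open>Smooth manifolds\<close>

text \<open>The manifold is the whole type \<open>'m\<close>, of dimension \<open>CARD('n)\<close>. A chart is a pair of
  its domain and its coordinate map.\<close>

type_synonym ('m, 'n) chart = "'m set \<times> ('m \<Rightarrow> real ^ 'n)"

primrec Ck_on ::
  "nat \<Rightarrow> (real ^ 'n::finite) set \<Rightarrow> (real ^ 'n \<Rightarrow> 'b::real_normed_vector) \<Rightarrow> bool" where
  "Ck_on 0 S f = continuous_on S f"
| "Ck_on (Suc k) S f =
     ((\<forall>x\<in>S. f differentiable at x) \<and>
      (\<forall>i. Ck_on k S (\<lambda>x. frechet_derivative f (at x) (axis i 1))))"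

text \<open>Used for open \<open>S\<close> only.\<close>

definition smooth_on ::
  "(real ^ 'n::finite) set \<Rightarrow> (real ^ 'n \<Rightarrow> 'b::real_normed_vector) \<Rightarrow> bool" where
  "smooth_on S f \<longleftrightarrow> (\<forall>k. Ck_on k S f)"

definition in_chart :: "('m, 'n) chart \<Rightarrow> ('m \<Rightarrow> 'b) \<Rightarrow> real ^ 'n \<Rightarrow> 'b" where
  "in_chart \<phi> f = f \<circ> inv_into (fst \<phi>) (snd \<phi>)"

definition smooth_atlas :: "('m::topological_space, 'n::finite) chart set \<Rightarrow> bool" where
  "smooth_atlas A \<longleftrightarrow>
     (\<Union>\<phi>\<in>A. fst \<phi>) = UNIV \<and>
     (\<forall>\<phi>\<in>A. open (fst \<phi>) \<and> open (snd \<phi> ` fst \<phi>) \<and>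
        homeomorphism (fst \<phi>) (snd \<phi> ` fst \<phi>) (snd \<phi>) (inv_into (fst \<phi>) (snd \<phi>))) \<and>
     (\<forall>\<phi>\<in>A. \<forall>\<psi>\<in>A. smooth_on (snd \<phi> ` (fst \<phi> \<inter> fst \<psi>)) (in_chart \<phi> (snd \<psi>)))"

definition smooth_fun_on ::
  "('m, 'n::finite) chart set \<Rightarrow> 'm set \<Rightarrow> ('m \<Rightarrow> 'b::real_normed_vector) \<Rightarrow> bool" where
  "smooth_fun_on A W f \<longleftrightarrow> (\<forall>\<phi>\<in>A. smooth_on (snd \<phi> ` (fst \<phi> \<inter> W)) (in_chart \<phi> f))"

text \<open>The coordinate derivative \<open>\<partial>\<^sub>i f\<close> at \<open>p\<close> with respect to the chart \<open>\<phi>\<close>.\<close>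

definition pd ::
  "('m, 'n::finite) chart \<Rightarrow> 'n \<Rightarrow> ('m \<Rightarrow> 'b::real_normed_vector) \<Rightarrow> 'm \<Rightarrow> 'b" where
  "pd \<phi> i f p =
     (if p \<in> fst \<phi> then frechet_derivative (in_chart \<phi> f) (at (snd \<phi> p)) (axis i 1) else 0)"

text \<open>\<open>jac \<phi> \<psi> k i p\<close> is \<open>\<partial>x\<^sup>k / \<partial>y\<^sup>i\<close> for \<open>x\<close> the coordinates of \<open>\<phi>\<close> and \<open>y\<close> those of \<open>\<psi>\<close>.\<close>

definition jac ::
  "('m, 'n::finite) chart \<Rightarrow> ('m, 'n) chart \<Rightarrow> 'n \<Rightarrow> 'n \<Rightarrow> 'm \<Rightarrow> real" where
  "jac \<phi> \<psi> k i p = pd \<psi> i (\<lambda>q. snd \<phi> q $ k) p"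


section \<open>Fibres of the bundle of symmetric tensors with values in forms\<close>

text \<open>A fibre element \<open>a\<close> stands for the formal sum, over all index lists \<open>I = [i\<^sub>1,\<dots>,i\<^sub>s]\<close> and
  \<open>J = [j\<^sub>1,\<dots>,j\<^sub>l]\<close>, of
  \<open>1/(s! l!) a I J dx\<^bsup>i\<^sub>1\<^esup> \<or> \<dots> \<or> dx\<^bsup>i\<^sub>s\<^esup> \<otimes> dx\<^bsup>j\<^sub>1\<^esup> \<and> \<dots> \<and> dx\<^bsup>j\<^sub>l\<^esup>\<close>,
  with \<open>a\<close> symmetric in \<open>I\<close> and alternating in \<open>J\<close>. There is no bound on \<open>s\<close>, so this is the
  direct product over all symmetric degrees. Thus a two-form
  \<open>1/2 \<alpha>\<^sub>i\<^sub>j dx\<^sup>i \<and> dx\<^sup>j\<close> has the components \<open>a [] [i, j] = \<alpha>\<^sub>i\<^sub>j\<close>.\<close>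

type_synonym ('n, 'v) fibre = "'n list \<Rightarrow> 'n list \<Rightarrow> 'v"

definition fibre_sym :: "('n, 'v) fibre \<Rightarrow> bool" where
  "fibre_sym a \<longleftrightarrow> (\<forall>I I' J. mset I = mset I' \<longrightarrow> a I J = a I' J)"

definition fibre_alt :: "('n, 'v::ring_1) fibre \<Rightarrow> bool" where
  "fibre_alt a \<longleftrightarrow>
     (\<forall>I J k l. k < l \<and> l < length J \<longrightarrow> a I (J[k := J ! l, l := J ! k]) = - a I J)"

definition remove_nth :: "nat \<Rightarrow> 'a list \<Rightarrow> 'a list" where
  "remove_nth m xs = take m xs @ drop (Suc m) xs"

definition one_fibre :: "('n, 'v::zero_neq_one) fibre" where
  "one_fibre I J = (if I = [] \<and> J = [] then 1 else 0)"

definition ins_s :: "'n \<Rightarrow> ('n, 'v) fibre \<Rightarrow> ('n, 'v) fibre" where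
  "ins_s k a I J = a (k # I) J"

definition ins_a :: "'n \<Rightarrow> ('n, 'v) fibre \<Rightarrow> ('n, 'v) fibre" where
  "ins_a k a I J = a I (k # J)"

text \<open>Left multiplication by \<open>dx\<^sup>k \<otimes> 1\<close> and by \<open>1 \<otimes> dx\<^sup>k\<close>.\<close>

definition dx_s :: "'n \<Rightarrow> ('n, 'v::ring_1) fibre \<Rightarrow> ('n, 'v) fibre" where
  "dx_s k a I J = (\<Sum>m<length I. if I ! m = k then a (remove_nth m I) J else 0)"

definition dx_a :: "'n \<Rightarrow> ('n, 'v::ring_1) fibre \<Rightarrow> ('n, 'v) fibre" where
  "dx_a k a I J = (\<Sum>m<length J. if J ! m = k then (-1) ^ m * a I (remove_nth m J) else 0)"

definition delta_fibre :: "('n::finite, 'v::ring_1) fibre \<Rightarrow> ('n, 'v) fibre" where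
  "delta_fibre a I J = (\<Sum>i\<in>UNIV. dx_a i (ins_s i a) I J)"

definition delta_star_fibre :: "('n::finite, 'v::ring_1) fibre \<Rightarrow> ('n, 'v) fibre" where
  "delta_star_fibre a I J = (\<Sum>i\<in>UNIV. dx_s i (ins_a i a) I J)"

text \<open>The operator \<open>\<delta>\<^sup>*\<close> preserves the sum \<open>k + l\<close> of the symmetric and the antisymmetric degree,
  which can therefore be read off from the result.\<close>

definition delta_inv_fibre :: "('n::finite, complex fps) fibre \<Rightarrow> ('n, complex fps) fibre" where
  "delta_inv_fibre a I J =
     (if length I + length J = 0 then 0
      else fps_const (1 / of_nat (length I + length J)) * delta_star_fibre a I J)"

text \<open>The product \<open>\<or> \<otimes> \<and>\<close> in components is the sum over all ways to distribute the indices
  to the two factors; the sign is that of the shuffle moving the positions in \<open>T\<close> to the front.\<close>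

definition shuffle_sign :: "nat \<Rightarrow> nat set \<Rightarrow> 'v::ring_1" where
  "shuffle_sign n T = (-1) ^ card {(u, t). u < t \<and> t < n \<and> t \<in> T \<and> u \<notin> T}"

definition mult_fibre :: "('n, 'v::ring_1) fibre \<Rightarrow> ('n, 'v) fibre \<Rightarrow> ('n, 'v) fibre" where
  "mult_fibre f g I J =
     (\<Sum>S\<in>Pow {..<length I}. \<Sum>T\<in>Pow {..<length J}.
        shuffle_sign (length J) T *
        (f (nths I S) (nths J T) * g (nths I (- S)) (nths J (- T))))"

definition index_lists :: "nat \<Rightarrow> 'n list set" where
  "index_lists m = {K. length K = m}"

text \<open>The \<open>m\<close>-th term of the exponential series defining the Weyl product for a bivector \<open>P\<close>.
  Iterated symmetric insertion of \<open>K = [k\<^sub>1,\<dots>,k\<^sub>m]\<close> is \<open>\<lambda>I. f (K @ I)\<close>.\<close>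

definition weyl_term ::
  "('n \<Rightarrow> 'n \<Rightarrow> real) \<Rightarrow> nat \<Rightarrow> ('n::finite, complex fps) fibre \<Rightarrow> ('n, complex fps) fibre
   \<Rightarrow> ('n, complex fps) fibre" where
  "weyl_term P m f g I J =
     fps_const (1 / fact m) * (fps_const (\<i> / 2) * fps_X) ^ m *
     (\<Sum>K\<in>index_lists m. \<Sum>L\<in>index_lists m.
        fps_const (of_real (\<Prod>t<m. P (K ! t) (L ! t))) *
        mult_fibre (\<lambda>I. f (K @ I)) (\<lambda>I. g (L @ I)) I J)"

text \<open>The \<open>m\<close>-th term is divisible by \<open>\<lambda>\<^sup>m\<close>, hence only \<open>m \<le> n\<close> contribute to the coefficient
  of \<open>\<lambda>\<^sup>n\<close>.\<close>

definition weyl_fibre ::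
  "('n \<Rightarrow> 'n \<Rightarrow> real) \<Rightarrow> ('n::finite, complex fps) fibre \<Rightarrow> ('n, complex fps) fibre
   \<Rightarrow> ('n, complex fps) fibre" where
  "weyl_fibre P f g I J = Abs_fps (\<lambda>n. fps_nth (\<Sum>m\<le>n. weyl_term P m f g I J) n)"

definition part_a :: "nat \<Rightarrow> ('n, 'v::zero) fibre \<Rightarrow> ('n, 'v) fibre" where
  "part_a l a I J = (if length J = l then a I J else 0)"

text \<open>Super-commutator with respect to the antisymmetric degree.\<close>

definition ad_fibre ::
  "('n \<Rightarrow> 'n \<Rightarrow> real) \<Rightarrow> ('n::finite, complex fps) fibre \<Rightarrow> ('n, complex fps) fibre
   \<Rightarrow> ('n, complex fps) fibre" where
  "ad_fibre P a b I J =
     (\<Sum>k\<le>length J. \<Sum>l\<le>length J.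
        weyl_fibre P (part_a k a) (part_a l b) I J
        - (-1) ^ (k * l) * weyl_fibre P (part_a l b) (part_a k a) I J)"


section \<open>Tensor fields\<close>

text \<open>A field is given by its components in every chart. For uniqueness of the representation the
  components vanish outside of the atlas and outside of the chart domains.\<close>

type_synonym ('m, 'n, 'v) field = "('m, 'n) chart \<Rightarrow> 'm \<Rightarrow> ('n, 'v) fibre"

definition smooth_sections ::
  "('m, 'n::finite) chart set \<Rightarrow> ('m, 'n, 'v::real_normed_field) field set" where
  "smooth_sections A =
     {a. (\<forall>\<phi> p. \<phi> \<notin> A \<or> p \<notin> fst \<phi> \<longrightarrow> (\<forall>I J. a \<phi> p I J = 0)) \<and>
         (\<forall>\<phi>\<in>A. \<forall>I J. smooth_on (snd \<phi> ` fst \<phi>) (in_chart \<phi> (\<lambda>p. a \<phi> p I J))) \<and>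
         (\<forall>\<phi>\<in>A. \<forall>p\<in>fst \<phi>. fibre_sym (a \<phi> p) \<and> fibre_alt (a \<phi> p)) \<and>
         (\<forall>\<phi>\<in>A. \<forall>\<psi>\<in>A. \<forall>p\<in>fst \<phi> \<inter> fst \<psi>. \<forall>I J.
            a \<psi> p I J =
              (\<Sum>I'\<in>index_lists (length I). \<Sum>J'\<in>index_lists (length J).
                 of_real ((\<Prod>m<length I. jac \<phi> \<psi> (I' ! m) (I ! m) p) *
                          (\<Prod>m<length J. jac \<phi> \<psi> (J' ! m) (J ! m) p)) *
                 a \<phi> p I' J'))}"

definition forms ::
  "('m, 'n::finite) chart set \<Rightarrow> nat \<Rightarrow> ('m, 'n, 'v::real_normed_field) field set" where
  "forms A l =
     {a \<in> smooth_sections A. \<forall>\<phi> p I J. I \<noteq> [] \<or> length J \<noteq> l \<longrightarrow> a \<phi> p I J = 0}"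

definition ext_d ::
  "('m, 'n::finite, 'v::real_normed_field) field \<Rightarrow> ('m, 'n, 'v) field" where
  "ext_d a \<phi> p I J = (\<Sum>i\<in>UNIV. dx_a i (\<lambda>I J. pd \<phi> i (\<lambda>q. a \<phi> q I J) p) I J)"

definition lambda_coeff :: "nat \<Rightarrow> ('m, 'n, complex fps) field \<Rightarrow> ('m, 'n, complex) field" where
  "lambda_coeff n a \<phi> p I J = fps_nth (a \<phi> p I J) n"

text \<open>The space \<open>\<W> \<otimes> \<Lambda>\<close>.\<close>

definition weyl_forms ::
  "('m, 'n::finite) chart set \<Rightarrow> ('m, 'n, complex fps) field set" where
  "weyl_forms A = {a. \<forall>n. lambda_coeff n a \<in> smooth_sections A}"

definition deg_a :: "nat \<Rightarrow> ('m, 'n, 'v::zero) field \<Rightarrow> bool" where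
  "deg_a l a \<longleftrightarrow> (\<forall>\<phi> p I J. length J \<noteq> l \<longrightarrow> a \<phi> p I J = 0)"

definition total_deg_ge :: "nat \<Rightarrow> ('m, 'n, complex fps) field \<Rightarrow> bool" where
  "total_deg_ge d a \<longleftrightarrow>
     (\<forall>\<phi> p I J n. 2 * n + length I < d \<longrightarrow> fps_nth (a \<phi> p I J) n = 0)"

definition const_field ::
  "('m, 'n, complex) field \<Rightarrow> ('m, 'n, complex fps) field" where
  "const_field a \<phi> p I J = fps_const (a \<phi> p I J)"

definition complexify :: "('m, 'n, real) field \<Rightarrow> ('m, 'n, complex) field" where
  "complexify a \<phi> p I J = of_real (a \<phi> p I J)"

definition scale_field :: "'v::times \<Rightarrow> ('m, 'n, 'v) field \<Rightarrow> ('m, 'n, 'v) field" where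
  "scale_field c a \<phi> p I J = c * a \<phi> p I J"

definition laurent :: "('m, 'n, complex fps) field \<Rightarrow> ('m, 'n, complex fls) field" where
  "laurent a \<phi> p I J = fps_to_fls (a \<phi> p I J)"

definition i_over_lambda :: "complex fls" where
  "i_over_lambda = fls_const \<i> * fls_X_inv"

definition smooth_series :: "('m, 'n::finite) chart set \<Rightarrow> ('m \<Rightarrow> complex fps) set" where
  "smooth_series A = {f. \<forall>n. smooth_fun_on A UNIV (\<lambda>p. fps_nth (f p) n)}"

definition delta ::
  "('m, 'n::finite, complex fps) field \<Rightarrow> ('m, 'n, complex fps) field" where
  "delta a \<phi> p = delta_fibre (a \<phi> p)"

definition delta_inv ::
  "('m, 'n::finite, complex fps) field \<Rightarrow> ('m, 'n, complex fps) field" where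
  "delta_inv a \<phi> p = delta_inv_fibre (a \<phi> p)"

text \<open>Symmetric and antisymmetric degree \<open>0\<close> components do not depend on the chart.\<close>

definition sigma ::
  "('m, 'n) chart set \<Rightarrow> ('m, 'n, complex fps) field \<Rightarrow> 'm \<Rightarrow> complex fps" where
  "sigma A a p = a (SOME \<phi>. \<phi> \<in> A \<and> p \<in> fst \<phi>) p [] []"


section \<open>Symplectic forms and connections\<close>

definition symplectic_form ::
  "('m, 'n::finite) chart set \<Rightarrow> ('m, 'n, real) field \<Rightarrow> bool" where
  "symplectic_form A \<omega> \<longleftrightarrow>
     \<omega> \<in> forms A 2 \<and> ext_d \<omega> = 0 \<and>
     (\<forall>\<phi>\<in>A. \<forall>p\<in>fst \<phi>. \<forall>v :: real ^ 'n.
        (\<forall>w :: real ^ 'n. (\<Sum>k\<in>UNIV. \<Sum>l\<in>UNIV. v $ k * w $ l * \<omega> \<phi> p [] [k, l]) = 0) \<longrightarrow> v = 0)"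

definition poisson_tensor ::
  "('m, 'n::finite, real) field \<Rightarrow> ('m, 'n) chart \<Rightarrow> 'm \<Rightarrow> 'n \<Rightarrow> 'n \<Rightarrow> real" where
  "poisson_tensor \<omega> \<phi> p k l = - (matrix_inv (\<chi> i j. \<omega> \<phi> p [] [i, j]) $ k $ l)"

text \<open>A connection on the tangent bundle is given by its Christoffel symbols in the charts:
  \<open>\<Gamma> \<phi> k i j p\<close> is \<open>\<Gamma>\<^sup>k\<^sub>i\<^sub>j\<close>, where \<open>\<nabla>\<^bsub>\<partial>\<^sub>i\<^esub> \<partial>\<^sub>j = \<Gamma>\<^sup>k\<^sub>i\<^sub>j \<partial>\<^sub>k\<close>. The transformation law says
  that the local operators agree on overlaps.\<close>

type_synonym ('m, 'n) christoffel = "('m, 'n) chart \<Rightarrow> 'n \<Rightarrow> 'n \<Rightarrow> 'n \<Rightarrow> 'm \<Rightarrow> real"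

definition connection ::
  "('m, 'n::finite) chart set \<Rightarrow> ('m, 'n) christoffel \<Rightarrow> bool" where
  "connection A \<Gamma> \<longleftrightarrow>
     (\<forall>\<phi>\<in>A. \<forall>k i j. smooth_on (snd \<phi> ` fst \<phi>) (in_chart \<phi> (\<Gamma> \<phi> k i j))) \<and>
     (\<forall>\<phi>\<in>A. \<forall>\<psi>\<in>A. \<forall>p\<in>fst \<phi> \<inter> fst \<psi>. \<forall>k a b.
        (\<Sum>c\<in>UNIV. \<Gamma> \<psi> c a b p * jac \<phi> \<psi> k c p) =
        pd \<psi> a (jac \<phi> \<psi> k b) p +
        (\<Sum>i\<in>UNIV. \<Sum>j\<in>UNIV. \<Gamma> \<phi> k i j p * jac \<phi> \<psi> i a p * jac \<phi> \<psi> j b p))"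

definition torsion_free :: "('m, 'n) chart set \<Rightarrow> ('m, 'n) christoffel \<Rightarrow> bool" where
  "torsion_free A \<Gamma> \<longleftrightarrow> (\<forall>\<phi>\<in>A. \<forall>p\<in>fst \<phi>. \<forall>k i j. \<Gamma> \<phi> k i j p = \<Gamma> \<phi> k j i p)"

definition pd_series ::
  "('m, 'n::finite) chart \<Rightarrow> 'n \<Rightarrow> ('m \<Rightarrow> complex fps) \<Rightarrow> 'm \<Rightarrow> complex fps" where
  "pd_series \<phi> i f p = Abs_fps (\<lambda>n. pd \<phi> i (\<lambda>q. fps_nth (f q) n) p)"

definition nabla ::
  "('m, 'n::finite) christoffel \<Rightarrow> ('m, 'n) chart \<Rightarrow> 'n \<Rightarrow> ('m, 'n, complex fps) field
   \<Rightarrow> 'm \<Rightarrow> ('n, complex fps) fibre" where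
  "nabla \<Gamma> \<phi> i a p I J =
     pd_series \<phi> i (\<lambda>q. a \<phi> q I J) p
     - (\<Sum>m<length I. \<Sum>k\<in>UNIV.
          fps_const (of_real (\<Gamma> \<phi> k i (I ! m) p)) * a \<phi> p (I[m := k]) J)
     - (\<Sum>m<length J. \<Sum>k\<in>UNIV.
          fps_const (of_real (\<Gamma> \<phi> k i (J ! m) p)) * a \<phi> p I (J[m := k]))"

definition symplectic_connection ::
  "('m, 'n::finite) chart set \<Rightarrow> ('m, 'n, real) field \<Rightarrow> ('m, 'n) christoffel \<Rightarrow> bool" where
  "symplectic_connection A \<omega> \<Gamma> \<longleftrightarrow>
     connection A \<Gamma> \<and>
     (\<forall>\<phi>\<in>A. \<forall>p\<in>fst \<phi>. \<forall>i. nabla \<Gamma> \<phi> i (const_field (complexify \<omega>)) p = 0)"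

definition cov_D ::
  "('m, 'n::finite) christoffel \<Rightarrow> ('m, 'n, complex fps) field \<Rightarrow> ('m, 'n, complex fps) field" where
  "cov_D \<Gamma> a \<phi> p I J = (\<Sum>i\<in>UNIV. dx_a i (nabla \<Gamma> \<phi> i a p) I J)"

text \<open>\<open>riemann \<Gamma> \<phi> p m k i j\<close> is \<open>R\<^sup>m\<^sub>k\<^sub>i\<^sub>j\<close>, where \<open>R(\<partial>\<^sub>i, \<partial>\<^sub>j) \<partial>\<^sub>k = R\<^sup>m\<^sub>k\<^sub>i\<^sub>j \<partial>\<^sub>m\<close> and
  \<open>R(\<partial>\<^sub>i, \<partial>\<^sub>j) = \<nabla>\<^sub>i \<nabla>\<^sub>j - \<nabla>\<^sub>j \<nabla>\<^sub>i\<close>.\<close>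

definition riemann ::
  "('m, 'n::finite) christoffel \<Rightarrow> ('m, 'n) chart \<Rightarrow> 'm \<Rightarrow> 'n \<Rightarrow> 'n \<Rightarrow> 'n \<Rightarrow> 'n \<Rightarrow> real" where
  "riemann \<Gamma> \<phi> p m k i j =
     pd \<phi> i (\<Gamma> \<phi> m j k) p - pd \<phi> j (\<Gamma> \<phi> m i k) p +
     (\<Sum>q\<in>UNIV. \<Gamma> \<phi> m i q p * \<Gamma> \<phi> q j k p - \<Gamma> \<phi> m j q p * \<Gamma> \<phi> q i k p)"

definition weyl_curvature ::
  "('m, 'n::finite, real) field \<Rightarrow> ('m, 'n) christoffel \<Rightarrow> ('m, 'n, complex fps) field" where
  "weyl_curvature \<omega> \<Gamma> \<phi> p I J =
     (\<Sum>l\<in>UNIV. \<Sum>k\<in>UNIV. \<Sum>i\<in>UNIV. \<Sum>j\<in>UNIV.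
        fps_const (of_real (1 / 4 * (\<Sum>m\<in>UNIV. \<omega> \<phi> p [] [l, m] * riemann \<Gamma> \<phi> p m k i j))) *
        dx_s l (dx_s k (dx_a i (dx_a j one_fibre))) I J)"


section \<open>Complex line bundles with connection\<close>

text \<open>A line bundle has the total space \<open>'l\<close>, a projection, and a family of local trivializations
  \<open>(U, t)\<close>, where \<open>t\<close> is the fibre coordinate on the part over \<open>U\<close>. The linear structure of the
  fibres and the smooth structure of the total space are those induced by the trivializations.\<close>

type_synonym ('l, 'm) trivialization = "'m set \<times> ('l \<Rightarrow> complex)"

record ('l, 'm) line_bundle =
  lb_proj :: "'l \<Rightarrow> 'm"
  lb_trivs :: "('l, 'm) trivialization set"

text \<open>The local frame with fibre coordinate \<open>1\<close>, and the transition function \<open>g\<close> with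
  \<open>s = g t\<close> for the fibre coordinates.\<close>

definition lb_frame :: "('l, 'm) line_bundle \<Rightarrow> ('l, 'm) trivialization \<Rightarrow> 'm \<Rightarrow> 'l" where
  "lb_frame L t p = (THE e. lb_proj L e = p \<and> snd t e = 1)"

definition lb_transition ::
  "('l, 'm) line_bundle \<Rightarrow> ('l, 'm) trivialization \<Rightarrow> ('l, 'm) trivialization \<Rightarrow> 'm \<Rightarrow> complex" where
  "lb_transition L t s p = snd s (lb_frame L t p)"

definition complex_line_bundle ::
  "('m::topological_space, 'n::finite) chart set \<Rightarrow> ('l, 'm) line_bundle \<Rightarrow> bool" where
  "complex_line_bundle A L \<longleftrightarrow>
     (\<Union>t\<in>lb_trivs L. fst t) = UNIV \<and>
     (\<forall>t\<in>lb_trivs L. open (fst t) \<and>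
        bij_betw (\<lambda>e. (lb_proj L e, snd t e)) (lb_proj L -` fst t) (fst t \<times> UNIV)) \<and>
     (\<forall>t\<in>lb_trivs L. \<forall>s\<in>lb_trivs L.
        smooth_fun_on A (fst t \<inter> fst s) (lb_transition L t s) \<and>
        (\<forall>p\<in>fst t \<inter> fst s. lb_transition L t s p \<noteq> 0) \<and>
        (\<forall>e. lb_proj L e \<in> fst t \<inter> fst s \<longrightarrow>
           snd s e = lb_transition L t s (lb_proj L e) * snd t e))"

text \<open>A connection on the line bundle is given by its connection one-forms: for the local frame
  \<open>e\<close> of \<open>t\<close>, one has \<open>\<nabla>\<^bsub>\<partial>\<^sub>i\<^esub> e = \<alpha> t \<phi> i \<cdot> e\<close>. The frame of \<open>s\<close> is \<open>1/g\<close> times the frame of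
  \<open>t\<close>, which gives the sign in the change of trivialization.\<close>

type_synonym ('l, 'm, 'n) lb_conn =
  "('l, 'm) trivialization \<Rightarrow> ('m, 'n) chart \<Rightarrow> 'n \<Rightarrow> 'm \<Rightarrow> complex"

definition line_bundle_connection ::
  "('m, 'n::finite) chart set \<Rightarrow> ('l, 'm) line_bundle \<Rightarrow> ('l, 'm, 'n) lb_conn \<Rightarrow> bool" where
  "line_bundle_connection A L \<alpha> \<longleftrightarrow>
     (\<forall>t\<in>lb_trivs L. \<forall>\<phi>\<in>A. \<forall>i.
        smooth_on (snd \<phi> ` (fst \<phi> \<inter> fst t)) (in_chart \<phi> (\<alpha> t \<phi> i))) \<and>
     (\<forall>t\<in>lb_trivs L. \<forall>\<phi>\<in>A. \<forall>\<psi>\<in>A. \<forall>p\<in>fst t \<inter> fst \<phi> \<inter> fst \<psi>. \<forall>i.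
        \<alpha> t \<psi> i p = (\<Sum>k\<in>UNIV. of_real (jac \<phi> \<psi> k i p) * \<alpha> t \<phi> k p)) \<and>
     (\<forall>t\<in>lb_trivs L. \<forall>s\<in>lb_trivs L. \<forall>\<phi>\<in>A. \<forall>p\<in>fst t \<inter> fst s \<inter> fst \<phi>. \<forall>i.
        \<alpha> s \<phi> i p = \<alpha> t \<phi> i p - pd \<phi> i (lb_transition L t s) p / lb_transition L t s p)"

text \<open>The curvature two-form is locally \<open>R\<^sup>L = d\<alpha>\<close>; the value at \<open>p\<close> does not depend on the
  trivialization around \<open>p\<close>.\<close>

definition lb_curvature ::
  "('m, 'n::finite) chart set \<Rightarrow> ('l, 'm) line_bundle \<Rightarrow> ('l, 'm, 'n) lb_conn
   \<Rightarrow> ('m, 'n, complex) field" where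
  "lb_curvature A L \<alpha> \<phi> p I J =
     (if \<phi> \<in> A \<and> p \<in> fst \<phi> \<and> I = [] \<and> length J = 2
      then let t = (SOME t. t \<in> lb_trivs L \<and> p \<in> fst t); i = J ! 0; j = J ! 1
           in pd \<phi> i (\<alpha> t \<phi> j) p - pd \<phi> j (\<alpha> t \<phi> i) p
      else 0)"


section \<open>De Rham classes\<close>

text \<open>The class of a closed two-form is its coset modulo the exact forms, and elements of
  \<open>H\<^sup>2(M; \<complex>)((\<lambda>))\<close> are given by their coefficients. Sums of classes are sums of sets.\<close>

type_synonym ('m, 'n) H2 = "('m, 'n, complex) field set"
type_synonym ('m, 'n) H2_laurent = "int \<Rightarrow> ('m, 'n) H2"

definition de_rham_class ::
  "('m, 'n::finite) chart set \<Rightarrow> ('m, 'n, complex) field \<Rightarrow> ('m, 'n) H2" where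
  "de_rham_class A a = {a + ext_d b | b. b \<in> forms A 1}"

definition de_rham_class_laurent ::
  "('m, 'n::finite) chart set \<Rightarrow> ('m, 'n, complex fls) field \<Rightarrow> ('m, 'n) H2_laurent" where
  "de_rham_class_laurent A a n = de_rham_class A (\<lambda>\<phi> p I J. fls_nth (a \<phi> p I J) n)"

definition H2_embed ::
  "('m, 'n::finite) chart set \<Rightarrow> ('m, 'n) H2 \<Rightarrow> ('m, 'n) H2_laurent" where
  "H2_embed A c n = (if n = 0 then c else de_rham_class A 0)"

text \<open>Multiplication of classes by a scalar \<open>z \<noteq> 0\<close>.\<close>

definition H2_scale :: "complex \<Rightarrow> ('m, 'n) H2_laurent \<Rightarrow> ('m, 'n) H2_laurent" where
  "H2_scale z c n = scale_field z ` c n"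

definition H2_div_lambda :: "('m, 'n) H2_laurent \<Rightarrow> ('m, 'n) H2_laurent" where
  "H2_div_lambda c n = c (n + 1)"

definition chern_class ::
  "('m, 'n::finite) chart set \<Rightarrow> ('l, 'm) line_bundle \<Rightarrow> ('l, 'm, 'n) lb_conn \<Rightarrow> ('m, 'n) H2" where
  "chern_class A L \<alpha> = de_rham_class A (scale_field (\<i> / (2 * of_real pi)) (lb_curvature A L \<alpha>))"


section \<open>The Fedosov construction\<close>

definition weyl_prod ::
  "('m, 'n::finite, real) field \<Rightarrow> ('m, 'n, complex fps) field \<Rightarrow> ('m, 'n, complex fps) field
   \<Rightarrow> ('m, 'n, complex fps) field" where
  "weyl_prod \<omega> a b \<phi> p = weyl_fibre (poisson_tensor \<omega> \<phi> p) (a \<phi> p) (b \<phi> p)"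

definition ad ::
  "('m, 'n::finite, real) field \<Rightarrow> ('m, 'n, complex fps) field \<Rightarrow> ('m, 'n, complex fps) field
   \<Rightarrow> ('m, 'n, complex fps) field" where
  "ad \<omega> a b \<phi> p = ad_fibre (poisson_tensor \<omega> \<phi> p) (a \<phi> p) (b \<phi> p)"

definition closed_two_form_series ::
  "('m, 'n::finite) chart set \<Rightarrow> ('m, 'n, complex fps) field \<Rightarrow> bool" where
  "closed_two_form_series A \<Omega> \<longleftrightarrow>
     (\<forall>n. lambda_coeff n \<Omega> \<in> forms A 2 \<and> ext_d (lambda_coeff n \<Omega>) = 0) \<and>
     lambda_coeff 0 \<Omega> = 0"

text \<open>\<open>K\<close> is the curvature term of the Fedosov equation.\<close>

definition fedosov_element ::
  "('m, 'n::finite) chart set \<Rightarrow> ('m, 'n, real) field \<Rightarrow> ('m, 'n) christoffel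
   \<Rightarrow> ('m, 'n, complex fps) field \<Rightarrow> ('m, 'n, complex fps) field \<Rightarrow> ('m, 'n, complex fps) field
   \<Rightarrow> bool" where
  "fedosov_element A \<omega> \<Gamma> K \<Omega> r \<longleftrightarrow>
     r \<in> weyl_forms A \<and> deg_a 1 r \<and> total_deg_ge 3 r \<and>
     laurent (delta r) =
       laurent (K + cov_D \<Gamma> r) + scale_field i_over_lambda (laurent (weyl_prod \<omega> r r)) + laurent \<Omega> \<and>
     delta_inv r = 0"

definition fedosov_derivative ::
  "('m, 'n::finite, real) field \<Rightarrow> ('m, 'n) christoffel \<Rightarrow> ('m, 'n, complex fps) field
   \<Rightarrow> ('m, 'n, complex fps) field \<Rightarrow> ('m, 'n, complex fls) field" where
  "fedosov_derivative \<omega> \<Gamma> r a =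
     laurent (- delta a + cov_D \<Gamma> a) + scale_field i_over_lambda (laurent (ad \<omega> r a))"

definition tau ::
  "('m, 'n::finite) chart set \<Rightarrow> ('m, 'n, real) field \<Rightarrow> ('m, 'n) christoffel
   \<Rightarrow> ('m, 'n, complex fps) field \<Rightarrow> ('m \<Rightarrow> complex fps) \<Rightarrow> ('m, 'n, complex fps) field" where
  "tau A \<omega> \<Gamma> r f =
     (THE a. a \<in> weyl_forms A \<and> deg_a 0 a \<and> fedosov_derivative \<omega> \<Gamma> r a = 0 \<and> sigma A a = f)"

text \<open>A Fedosov star product comes with the Fedosov derivative, here given by \<open>r\<close>, that it is
  obtained from; its Fedosov class is defined in terms of the latter.\<close>

record ('m, 'n) star_product =
  star_r :: "('m, 'n, complex fps) field"
  star_mult :: "('m \<Rightarrow> complex fps) \<Rightarrow> ('m \<Rightarrow> complex fps) \<Rightarrow> ('m \<Rightarrow> complex fps)"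

definition fedosov_mult ::
  "('m, 'n::finite) chart set \<Rightarrow> ('m, 'n, real) field \<Rightarrow> ('m, 'n) christoffel
   \<Rightarrow> ('m, 'n) star_product \<Rightarrow> bool" where
  "fedosov_mult A \<omega> \<Gamma> S \<longleftrightarrow>
     (\<forall>f\<in>smooth_series A. \<forall>g\<in>smooth_series A.
        star_mult S f g =
          sigma A (weyl_prod \<omega> (tau A \<omega> \<Gamma> (star_r S) f) (tau A \<omega> \<Gamma> (star_r S) g)))"

definition fedosov_star_product ::
  "('m, 'n::finite) chart set \<Rightarrow> ('m, 'n, real) field \<Rightarrow> ('m, 'n) christoffel
   \<Rightarrow> ('m, 'n, complex fps) field \<Rightarrow> ('m, 'n) star_product \<Rightarrow> bool" where
  "fedosov_star_product A \<omega> \<Gamma> \<Omega> S \<longleftrightarrow>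
     fedosov_element A \<omega> \<Gamma> (weyl_curvature \<omega> \<Gamma>) \<Omega> (star_r S) \<and> fedosov_mult A \<omega> \<Gamma> S"

text \<open>The product on the sections of \<open>End(L)\<close>, which is canonically the trivial line bundle with the
  trivial connection.\<close>

definition fedosov_End_product ::
  "('m, 'n::finite) chart set \<Rightarrow> ('m, 'n, real) field \<Rightarrow> ('m, 'n) christoffel
   \<Rightarrow> ('l, 'm) line_bundle \<Rightarrow> ('l, 'm, 'n) lb_conn
   \<Rightarrow> ('m, 'n, complex fps) field \<Rightarrow> ('m, 'n) star_product \<Rightarrow> bool" where
  "fedosov_End_product A \<omega> \<Gamma> L \<alpha> \<Omega> S \<longleftrightarrow>
     fedosov_element A \<omega> \<Gamma>
       (weyl_curvature \<omega> \<Gamma> - scale_field (fps_const \<i> * fps_X) (const_field (lb_curvature A L \<alpha>)))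
       \<Omega> (star_r S) \<and>
     fedosov_mult A \<omega> \<Gamma> S"

definition fedosov_class ::
  "('m, 'n::finite) chart set \<Rightarrow> ('m, 'n, real) field \<Rightarrow> ('m, 'n) christoffel
   \<Rightarrow> ('m, 'n) star_product \<Rightarrow> ('m, 'n) H2_laurent" where
  "fedosov_class A \<omega> \<Gamma> S =
     de_rham_class_laurent A
       (let r = star_r S in
          laurent (const_field (complexify \<omega>) + delta r - weyl_curvature \<omega> \<Gamma> - cov_D \<Gamma> r)
          - scale_field i_over_lambda (laurent (weyl_prod \<omega> r r)))"

definition characteristic_class ::
  "('m, 'n::finite) chart set \<Rightarrow> ('m, 'n, real) field \<Rightarrow> ('m, 'n) christoffel
   \<Rightarrow> ('m, 'n) star_product \<Rightarrow> ('m, 'n) H2_laurent" where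
  "characteristic_class A \<omega> \<Gamma> S = H2_scale (1 / \<i>) (H2_div_lambda (fedosov_class A \<omega> \<Gamma> S))"

end

theory Submission
  imports Defs
begin

text \<open>Solving the two Fedosov equations for the curvature expression that defines the Fedosov
  class, everything depending on \<open>r\<close> and \<open>r'\<close> cancels: the representatives of the two classes
  are \<open>\<omega> + \<Omega>\<close> and \<open>\<omega> + \<Omega> - \<i>\<lambda>R\<^sup>L\<close>. Dividing by \<open>\<i>\<lambda>\<close>, the characteristic classes differ by
  \<open>-[R\<^sup>L] = 2\<pi>\<i> c\<^sub>1(L)\<close>. What remains is that de Rham classes depend linearly on their
  representatives, which holds because they are the cosets of a linear subspace.\<close>

section \<open>Smooth functions\<close>

lemma Ck_on_cong:
  assumes "open S" "\<And>x. x \<in> S \<Longrightarrow> f x = g x" "Ck_on k S f"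
  shows "Ck_on k S g"
  using assms(2,3)
proof (induction k arbitrary: f g)
  case 0
  then show ?case by (simp cong: continuous_on_cong)
next
  case (Suc k)
  have g_deriv: "(g has_derivative frechet_derivative f (at x)) (at x)" if "x \<in> S" for x
  proof (rule has_derivative_transform_within_open)
    show "(f has_derivative frechet_derivative f (at x)) (at x)"
      using Suc.prems(2) that by (simp add: frechet_derivative_works)
  qed (use assms(1) that Suc.prems(1) in auto)
  have frechet_eq: "frechet_derivative f (at x) = frechet_derivative g (at x)" if "x \<in> S" for x
    by (rule frechet_derivative_at[OF g_deriv[OF that]])
  have "Ck_on k S (\<lambda>x. frechet_derivative g (at x) (axis i 1))" for i
  proof (rule Suc.IH)
    show "Ck_on k S (\<lambda>x. frechet_derivative f (at x) (axis i 1))"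
      using Suc.prems(2) by simp
  qed (simp add: frechet_eq)
  with g_deriv show ?case
    unfolding Ck_on.simps by (blast intro: differentiableI)
qed

lemma Ck_on_SucI:
  assumes "open S"
    and f_deriv: "\<And>x. x \<in> S \<Longrightarrow> (f has_derivative f' x) (at x)"
    and "\<And>i. Ck_on k S (\<lambda>x. f' x (axis i 1))"
  shows "Ck_on (Suc k) S f"
proof -
  have "f' x (axis i 1) = frechet_derivative f (at x) (axis i 1)" if "x \<in> S" for x i
    using frechet_derivative_at[OF f_deriv[OF that]] by simp
  from Ck_on_cong[OF \<open>open S\<close> this assms(3)] f_deriv show ?thesis
    unfolding Ck_on.simps by (blast intro: differentiableI)
qed

lemma Ck_on_Suc_has_derivative:
  "Ck_on (Suc k) S f \<Longrightarrow> x \<in> S \<Longrightarrow> (f has_derivative frechet_derivative f (at x)) (at x)"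
  by (simp add: frechet_derivative_works)

lemma Ck_on_const: "Ck_on k S (\<lambda>x. c)"
  by (induction k arbitrary: c) simp_all

lemma Ck_on_add:
  assumes "open S" "Ck_on k S f" "Ck_on k S g"
  shows "Ck_on k S (\<lambda>x. f x + g x)"
  using assms(2,3)
proof (induction k arbitrary: f g)
  case 0
  then show ?case by (simp add: continuous_on_add)
next
  case (Suc k)
  show ?case
  proof (rule Ck_on_SucI[OF \<open>open S\<close>])
    show "((\<lambda>x. f x + g x) has_derivative
        (\<lambda>v. frechet_derivative f (at x) v + frechet_derivative g (at x) v)) (at x)"
      if "x \<in> S" for x
      using Suc.prems that by (intro has_derivative_add Ck_on_Suc_has_derivative)
  qed (use Suc in simp)
qed

lemma Ck_on_bounded_linear:
  assumes "open S" "bounded_linear h" "Ck_on k S f"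
  shows "Ck_on k S (\<lambda>x. h (f x))"
  using assms(3)
proof (induction k arbitrary: f)
  case 0
  then show ?case by (simp add: bounded_linear.continuous_on[OF assms(2)])
next
  case (Suc k)
  show ?case
  proof (rule Ck_on_SucI[OF \<open>open S\<close>])
    show "((\<lambda>x. h (f x)) has_derivative (\<lambda>v. h (frechet_derivative f (at x) v))) (at x)"
      if "x \<in> S" for x
      using Suc.prems that
      by (intro bounded_linear.has_derivative[OF assms(2)] Ck_on_Suc_has_derivative)
  qed (use Suc in simp)
qed

lemma smooth_on_const: "smooth_on S (\<lambda>x. c)"
  by (simp add: smooth_on_def Ck_on_const)

lemma smooth_on_add:
  "open S \<Longrightarrow> smooth_on S f \<Longrightarrow> smooth_on S g \<Longrightarrow> smooth_on S (\<lambda>x. f x + g x)"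
  by (simp add: smooth_on_def Ck_on_add)

lemma smooth_on_bounded_linear:
  "open S \<Longrightarrow> bounded_linear h \<Longrightarrow> smooth_on S f \<Longrightarrow> smooth_on S (\<lambda>x. h (f x))"
  by (simp add: smooth_on_def Ck_on_bounded_linear)

lemma smooth_on_imp_differentiable_at: "smooth_on S f \<Longrightarrow> x \<in> S \<Longrightarrow> f differentiable at x"
  unfolding smooth_on_def using Ck_on.simps(2) by blast

lemma pd_add:
  assumes "p \<in> fst \<phi> \<Longrightarrow> in_chart \<phi> f differentiable at (snd \<phi> p)"
    and "p \<in> fst \<phi> \<Longrightarrow> in_chart \<phi> g differentiable at (snd \<phi> p)"
  shows "pd \<phi> i (\<lambda>q. f q + g q) p = pd \<phi> i f p + pd \<phi> i g p"
proof (cases "p \<in> fst \<phi>")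
  case True
  have "((\<lambda>x. in_chart \<phi> f x + in_chart \<phi> g x) has_derivative
      (\<lambda>v. frechet_derivative (in_chart \<phi> f) (at (snd \<phi> p)) v
         + frechet_derivative (in_chart \<phi> g) (at (snd \<phi> p)) v)) (at (snd \<phi> p))"
    using assms True by (intro has_derivative_add) (simp_all add: frechet_derivative_works)
  from frechet_derivative_at[OF this, symmetric] True show ?thesis
    by (simp add: pd_def in_chart_def o_def)
qed (simp add: pd_def)

lemma pd_bounded_linear:
  assumes "bounded_linear h"
    and "p \<in> fst \<phi> \<Longrightarrow> in_chart \<phi> f differentiable at (snd \<phi> p)"
  shows "pd \<phi> i (\<lambda>q. h (f q)) p = h (pd \<phi> i f p)"
proof (cases "p \<in> fst \<phi>")
  case True
  have "((\<lambda>x. h (in_chart \<phi> f x)) has_derivative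
      (\<lambda>v. h (frechet_derivative (in_chart \<phi> f) (at (snd \<phi> p)) v))) (at (snd \<phi> p))"
    using assms True
    by (intro bounded_linear.has_derivative[OF assms(1)]) (simp add: frechet_derivative_works)
  from frechet_derivative_at[OF this, symmetric] True show ?thesis
    by (simp add: pd_def in_chart_def o_def)
qed (simp add: pd_def linear_0[OF bounded_linear.linear[OF assms(1)]])

section \<open>Tensor fields and the exterior derivative\<close>

definition scale_fibre :: "'v::times \<Rightarrow> ('n, 'v) fibre \<Rightarrow> ('n, 'v) fibre" where
  "scale_fibre c a I J = c * a I J"

definition chart_change ::
  "('m, 'n::finite) chart \<Rightarrow> ('m, 'n) chart \<Rightarrow> 'm \<Rightarrow> ('n, 'v::real_algebra_1) fibre
   \<Rightarrow> ('n, 'v) fibre" where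
  "chart_change \<phi> \<psi> p a I J =
     (\<Sum>I'\<in>index_lists (length I). \<Sum>J'\<in>index_lists (length J).
        of_real ((\<Prod>m<length I. jac \<phi> \<psi> (I' ! m) (I ! m) p) *
                 (\<Prod>m<length J. jac \<phi> \<psi> (J' ! m) (J ! m) p)) * a I' J')"

lemma scale_field_apply: "scale_field c a \<phi> p = scale_fibre c (a \<phi> p)"
  by (intro ext) (simp add: scale_field_def scale_fibre_def)

lemma chart_change_zero: "chart_change \<phi> \<psi> p 0 = 0"
  by (intro ext) (simp add: chart_change_def)

lemma chart_change_add: "chart_change \<phi> \<psi> p (a + b) = chart_change \<phi> \<psi> p a + chart_change \<phi> \<psi> p b"
  by (intro ext) (simp add: chart_change_def distrib_left sum.distrib)

lemma chart_change_scale: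
  fixes a :: "('n::finite, 'v::real_field) fibre"
  shows "chart_change \<phi> \<psi> p (scale_fibre c a) = scale_fibre c (chart_change \<phi> \<psi> p a)"
  by (intro ext)
    (simp add: chart_change_def scale_fibre_def sum_distrib_left mult.left_commute[of _ c])

lemma fibre_sym_zero: "fibre_sym 0"
  by (simp add: fibre_sym_def)

lemma fibre_sym_add:
  assumes "fibre_sym a" "fibre_sym b"
  shows "fibre_sym (a + b)"
  using assms unfolding fibre_sym_def plus_fun_apply by metis

lemma fibre_sym_scale: "fibre_sym a \<Longrightarrow> fibre_sym (scale_fibre c a)"
  unfolding fibre_sym_def scale_fibre_def by metis

lemma fibre_alt_zero: "fibre_alt 0"
  by (simp add: fibre_alt_def)

lemma fibre_alt_add: "fibre_alt a \<Longrightarrow> fibre_alt b \<Longrightarrow> fibre_alt (a + b)"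
  by (simp add: fibre_alt_def)

lemma fibre_alt_scale: "fibre_alt a \<Longrightarrow> fibre_alt (scale_fibre c a)"
  by (simp add: fibre_alt_def scale_fibre_def)

lemma dx_a_add: "dx_a k (a + b) = dx_a k a + dx_a k b"
  by (intro ext) (auto simp: dx_a_def distrib_left simp flip: sum.distrib intro!: sum.cong)

lemma dx_a_scale:
  fixes a :: "('n, 'v::comm_ring_1) fibre"
  shows "dx_a k (scale_fibre c a) = scale_fibre c (dx_a k a)"
  by (intro ext)
    (simp add: dx_a_def scale_fibre_def sum_distrib_left if_distrib mult.left_commute cong: if_cong)

interpretation tensor_field: vector_space
  "scale_field :: 'v::field \<Rightarrow> ('m, 'n, 'v) field \<Rightarrow> ('m, 'n, 'v) field"
  by unfold_locales
    (simp_all add: scale_field_def fun_eq_iff distrib_left distrib_right mult.assoc)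

lemma smooth_atlas_open_image: "smooth_atlas A \<Longrightarrow> \<phi> \<in> A \<Longrightarrow> open (snd \<phi> ` fst \<phi>)"
  by (simp add: smooth_atlas_def)

lemma smooth_sectionsI:
  assumes "\<And>\<phi> p. \<phi> \<notin> A \<or> p \<notin> fst \<phi> \<Longrightarrow> a \<phi> p = 0"
    and "\<And>\<phi> I J. \<phi> \<in> A \<Longrightarrow> smooth_on (snd \<phi> ` fst \<phi>) (in_chart \<phi> (\<lambda>p. a \<phi> p I J))"
    and "\<And>\<phi> p. \<phi> \<in> A \<Longrightarrow> p \<in> fst \<phi> \<Longrightarrow> fibre_sym (a \<phi> p)"
    and "\<And>\<phi> p. \<phi> \<in> A \<Longrightarrow> p \<in> fst \<phi> \<Longrightarrow> fibre_alt (a \<phi> p)"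
    and "\<And>\<phi> \<psi> p. \<phi> \<in> A \<Longrightarrow> \<psi> \<in> A \<Longrightarrow> p \<in> fst \<phi> \<inter> fst \<psi> \<Longrightarrow>
      a \<psi> p = chart_change \<phi> \<psi> p (a \<phi> p)"
  shows "a \<in> smooth_sections A"
  using assms unfolding smooth_sections_def chart_change_def fun_eq_iff zero_fun_apply by blast

lemma
  assumes "a \<in> smooth_sections A"
  shows smooth_section_outside: "\<phi> \<notin> A \<or> p \<notin> fst \<phi> \<Longrightarrow> a \<phi> p = 0"
    and smooth_section_smooth_on:
      "\<phi> \<in> A \<Longrightarrow> smooth_on (snd \<phi> ` fst \<phi>) (in_chart \<phi> (\<lambda>p. a \<phi> p I J))"
    and smooth_section_sym: "\<phi> \<in> A \<Longrightarrow> p \<in> fst \<phi> \<Longrightarrow> fibre_sym (a \<phi> p)"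
    and smooth_section_alt: "\<phi> \<in> A \<Longrightarrow> p \<in> fst \<phi> \<Longrightarrow> fibre_alt (a \<phi> p)"
    and smooth_section_chart_change: "\<phi> \<in> A \<Longrightarrow> \<psi> \<in> A \<Longrightarrow> p \<in> fst \<phi> \<inter> fst \<psi> \<Longrightarrow>
      a \<psi> p = chart_change \<phi> \<psi> p (a \<phi> p)"
  using assms unfolding smooth_sections_def chart_change_def fun_eq_iff zero_fun_apply by blast+

lemma zero_in_smooth_sections: "0 \<in> smooth_sections A"
  by (rule smooth_sectionsI) (simp_all add: in_chart_def o_def smooth_on_const fibre_sym_zero
      fibre_alt_zero chart_change_zero)

lemma add_in_smooth_sections:
  assumes "smooth_atlas A" and a: "a \<in> smooth_sections A" and b: "b \<in> smooth_sections A"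
  shows "a + b \<in> smooth_sections A"
proof (rule smooth_sectionsI)
  fix \<phi> I J assume "\<phi> \<in> A"
  then have "smooth_on (snd \<phi> ` fst \<phi>)
      (\<lambda>x. in_chart \<phi> (\<lambda>p. a \<phi> p I J) x + in_chart \<phi> (\<lambda>p. b \<phi> p I J) x)"
    by (intro smooth_on_add smooth_atlas_open_image[OF assms(1)] smooth_section_smooth_on[OF a]
        smooth_section_smooth_on[OF b])
  then show "smooth_on (snd \<phi> ` fst \<phi>) (in_chart \<phi> (\<lambda>p. (a + b) \<phi> p I J))"
    by (simp add: in_chart_def o_def)
next
  fix \<phi> \<psi> p assume "\<phi> \<in> A" "\<psi> \<in> A" "p \<in> fst \<phi> \<inter> fst \<psi>"
  then show "(a + b) \<psi> p = chart_change \<phi> \<psi> p ((a + b) \<phi> p)"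
    by (simp only: plus_fun_apply chart_change_add smooth_section_chart_change[OF a, of \<phi> \<psi>]
        smooth_section_chart_change[OF b, of \<phi> \<psi>])
qed (auto simp: smooth_section_outside[OF a] smooth_section_outside[OF b]
    smooth_section_sym[OF a] smooth_section_sym[OF b] fibre_sym_add
    smooth_section_alt[OF a] smooth_section_alt[OF b] fibre_alt_add)

lemma scale_in_smooth_sections:
  assumes "smooth_atlas A" and a: "a \<in> smooth_sections A"
  shows "scale_field c a \<in> smooth_sections A"
proof (rule smooth_sectionsI)
  fix \<phi> I J assume "\<phi> \<in> A"
  then have "smooth_on (snd \<phi> ` fst \<phi>) (\<lambda>x. c * in_chart \<phi> (\<lambda>p. a \<phi> p I J) x)"
    by (intro smooth_on_bounded_linear[OF _ bounded_linear_mult_right]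
        smooth_atlas_open_image[OF assms(1)] smooth_section_smooth_on[OF a])
  then show "smooth_on (snd \<phi> ` fst \<phi>) (in_chart \<phi> (\<lambda>p. scale_field c a \<phi> p I J))"
    by (simp add: in_chart_def o_def scale_field_def)
next
  fix \<phi> \<psi> p assume "\<phi> \<in> A" "\<psi> \<in> A" "p \<in> fst \<phi> \<inter> fst \<psi>"
  then show "scale_field c a \<psi> p = chart_change \<phi> \<psi> p (scale_field c a \<phi> p)"
    by (simp only: scale_field_apply chart_change_scale
        smooth_section_chart_change[OF a, of \<phi> \<psi>])
next
  show "scale_field c a \<phi> p = 0" if "\<phi> \<notin> A \<or> p \<notin> fst \<phi>" for \<phi> p
    using smooth_section_outside[OF a that] by (simp add: fun_eq_iff scale_field_def)
qed (simp_all add: scale_field_apply smooth_section_sym[OF a] fibre_sym_scale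
    smooth_section_alt[OF a] fibre_alt_scale)

lemma subspace_smooth_sections:
  "smooth_atlas A \<Longrightarrow> tensor_field.subspace (smooth_sections A)"
  by (intro tensor_field.subspaceI zero_in_smooth_sections add_in_smooth_sections
      scale_in_smooth_sections)

lemma form_imp_smooth_section: "a \<in> forms A l \<Longrightarrow> a \<in> smooth_sections A"
  by (simp add: forms_def)

lemma subspace_forms:
  assumes "smooth_atlas A"
  shows "tensor_field.subspace (forms A l)"
  using subspace_smooth_sections[OF assms]
  unfolding tensor_field.subspace_def forms_def by (auto simp: scale_field_def)

lemma smooth_section_differentiable:
  assumes "a \<in> smooth_sections A" "p \<in> fst \<phi>"
  shows "in_chart \<phi> (\<lambda>q. a \<phi> q I J) differentiable at (snd \<phi> p)"
proof (cases "\<phi> \<in> A")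
  case True
  with assms show ?thesis
    by (blast intro: smooth_section_smooth_on smooth_on_imp_differentiable_at)
next
  case False
  then show ?thesis
    by (simp add: smooth_section_outside[OF assms(1)] in_chart_def o_def)
qed

lemma ext_d_add:
  assumes "a \<in> smooth_sections A" "b \<in> smooth_sections A"
  shows "ext_d (a + b) = ext_d a + ext_d b"
proof (intro ext)
  fix \<phi> p I J
  have "(\<lambda>I J. pd \<phi> i (\<lambda>q. (a + b) \<phi> q I J) p) =
      (\<lambda>I J. pd \<phi> i (\<lambda>q. a \<phi> q I J) p) + (\<lambda>I J. pd \<phi> i (\<lambda>q. b \<phi> q I J) p)" for i
    by (intro ext) (simp add: pd_add smooth_section_differentiable[OF assms(1)]
        smooth_section_differentiable[OF assms(2)])
  then show "ext_d (a + b) \<phi> p I J = (ext_d a + ext_d b) \<phi> p I J"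
    by (simp add: ext_d_def dx_a_add sum.distrib)
qed

lemma ext_d_scale:
  assumes "a \<in> smooth_sections A"
  shows "ext_d (scale_field c a) = scale_field c (ext_d a)"
proof (intro ext)
  fix \<phi> p I J
  have "(\<lambda>I J. pd \<phi> i (\<lambda>q. scale_field c a \<phi> q I J) p) =
      scale_fibre c (\<lambda>I J. pd \<phi> i (\<lambda>q. a \<phi> q I J) p)" for i
    by (intro ext) (simp add: scale_field_def scale_fibre_def smooth_section_differentiable[OF assms]
        pd_bounded_linear[OF bounded_linear_mult_right])
  then have "ext_d (scale_field c a) \<phi> p I J =
      (\<Sum>i\<in>UNIV. scale_fibre c (dx_a i (\<lambda>I J. pd \<phi> i (\<lambda>q. a \<phi> q I J) p)) I J)"
    by (simp only: ext_d_def dx_a_scale)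
  then show "ext_d (scale_field c a) \<phi> p I J = scale_field c (ext_d a) \<phi> p I J"
    by (simp add: scale_field_def scale_fibre_def ext_d_def sum_distrib_left)
qed

lemma ext_d_zero: "ext_d 0 = 0"
  using ext_d_scale[OF zero_in_smooth_sections, of 0] by simp

lemma subspace_exact_forms:
  assumes "smooth_atlas A"
  shows "tensor_field.subspace (ext_d ` forms A l)" (is "tensor_field.subspace ?E")
proof (rule tensor_field.subspaceI)
  show "0 \<in> ?E"
    using imageI[OF tensor_field.subspace_0[OF subspace_forms[OF assms]], of ext_d]
    by (simp only: ext_d_zero)
next
  fix x y assume "x \<in> ?E" "y \<in> ?E"
  then obtain a b where ab: "a \<in> forms A l" "b \<in> forms A l" and "x = ext_d a" "y = ext_d b"
    by blast
  then have "x + y = ext_d (a + b)"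
    by (simp add: ext_d_add[OF ab[THEN form_imp_smooth_section]])
  then show "x + y \<in> ?E"
    using tensor_field.subspace_add[OF subspace_forms[OF assms] ab] by (rule image_eqI)
next
  fix c x assume "x \<in> ?E"
  then obtain a where a: "a \<in> forms A l" and "x = ext_d a"
    by blast
  then have "scale_field c x = ext_d (scale_field c a)"
    by (simp add: ext_d_scale[OF form_imp_smooth_section[OF a]])
  then show "scale_field c x \<in> ?E"
    using tensor_field.subspace_scale[OF subspace_forms[OF assms] a] by (rule image_eqI)
qed

section \<open>De Rham classes\<close>

lemma elt_set_plus_eq_image: "a +o B = (+) a ` B"
  by (auto simp: elt_set_plus_def)

lemma (in module) coset_plus_coset:
  assumes "subspace B"
  shows "(a +o B) + (b +o B) = (a + b) +o B"
proof -
  have "B + B = B"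
  proof
    show "B + B \<subseteq> B"
      using subspace_add[OF assms] by (auto elim: set_plus_elim)
    show "B \<subseteq> B + B"
      using subspace_0[OF assms] by (rule set_zero_plus2)
  qed
  then show ?thesis by (simp add: set_plus_rearrange)
qed

lemma (in vector_space) scale_image_coset:
  assumes "subspace B" "c \<noteq> 0"
  shows "scale c ` (a +o B) = scale c a +o B"
proof -
  have "scale c ` B = B"
  proof
    show "scale c ` B \<subseteq> B"
      using subspace_scale[OF assms(1)] by blast
    show "B \<subseteq> scale c ` B"
    proof
      fix x assume "x \<in> B"
      then have "scale (inverse c) x \<in> B" by (rule subspace_scale[OF assms(1)])
      moreover have "x = scale c (scale (inverse c) x)" using assms(2) by simp
      ultimately show "x \<in> scale c ` B" by blast
    qed
  qed
  moreover have "scale c ` (a +o B) = scale c a +o scale c ` B"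
    by (simp add: elt_set_plus_eq_image image_image scale_right_distrib)
  ultimately show ?thesis by simp
qed

lemma de_rham_class_eq_coset: "de_rham_class A a = a +o ext_d ` forms A 1"
  by (auto simp: de_rham_class_def elt_set_plus_def)

lemma de_rham_class_add:
  "smooth_atlas A \<Longrightarrow> de_rham_class A (a + b) = de_rham_class A a + de_rham_class A b"
  by (simp add: de_rham_class_eq_coset tensor_field.coset_plus_coset subspace_exact_forms)

lemma de_rham_class_scale:
  "smooth_atlas A \<Longrightarrow> c \<noteq> 0 \<Longrightarrow>
    de_rham_class A (scale_field c a) = scale_field c ` de_rham_class A a"
  by (simp add: de_rham_class_eq_coset tensor_field.scale_image_coset subspace_exact_forms)

lemma de_rham_class_laurent_add:
  assumes "smooth_atlas A"
  shows "de_rham_class_laurent A (a + b) = de_rham_class_laurent A a + de_rham_class_laurent A b"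
proof
  fix n
  show "de_rham_class_laurent A (a + b) n =
      (de_rham_class_laurent A a + de_rham_class_laurent A b) n"
    unfolding plus_fun_apply de_rham_class_laurent_def de_rham_class_add[OF assms, symmetric]
    by (rule arg_cong[where f = "de_rham_class A"]) (simp add: fun_eq_iff)
qed

lemma H2_scale_de_rham_class_laurent:
  assumes "smooth_atlas A" "z \<noteq> 0"
  shows "H2_scale z (de_rham_class_laurent A a) =
    de_rham_class_laurent A (scale_field (fls_const z) a)"
proof
  fix n
  show "H2_scale z (de_rham_class_laurent A a) n =
      de_rham_class_laurent A (scale_field (fls_const z) a) n"
    unfolding H2_scale_def de_rham_class_laurent_def de_rham_class_scale[OF assms, symmetric]
    by (rule arg_cong[where f = "de_rham_class A"]) (simp add: fun_eq_iff scale_field_def)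
qed

lemma H2_div_lambda_de_rham_class_laurent:
  "H2_div_lambda (de_rham_class_laurent A a) = de_rham_class_laurent A (scale_field fls_X_inv a)"
  by (simp add: fun_eq_iff H2_div_lambda_def de_rham_class_laurent_def scale_field_def
      fls_X_inv_times_conv_shift)

lemma H2_embed_de_rham_class:
  "H2_embed A (de_rham_class A a) = de_rham_class_laurent A (laurent (const_field a))"
proof
  fix n
  have "(\<lambda>\<phi> p I J. fls_nth (laurent (const_field a) \<phi> p I J) n) = (if n = 0 then a else 0)"
    by (auto simp: fun_eq_iff laurent_def const_field_def)
  then show "H2_embed A (de_rham_class A a) n =
      de_rham_class_laurent A (laurent (const_field a)) n"
    by (simp add: H2_embed_def de_rham_class_laurent_def)
qed

section \<open>Characteristic classes of Fedosov star products\<close>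

lemma laurent_add: "laurent (a + b) = laurent a + laurent b"
  by (simp add: fun_eq_iff laurent_def)

lemma laurent_diff: "laurent (a - b) = laurent a - laurent b"
  by (simp add: fun_eq_iff laurent_def)

lemma fedosov_class_eq:
  assumes "fedosov_element A \<omega> \<Gamma> (weyl_curvature \<omega> \<Gamma> + K) \<Omega> (star_r S)"
  shows "fedosov_class A \<omega> \<Gamma> S =
    de_rham_class_laurent A (laurent (const_field (complexify \<omega>) + \<Omega> + K))"
proof -
  define r where "r = star_r S"
  have "laurent (delta r) = laurent (weyl_curvature \<omega> \<Gamma> + K + cov_D \<Gamma> r)
      + scale_field i_over_lambda (laurent (weyl_prod \<omega> r r)) + laurent \<Omega>"
    using assms by (simp add: fedosov_element_def r_def)
  then have "laurent (const_field (complexify \<omega>) + delta r - weyl_curvature \<omega> \<Gamma> - cov_D \<Gamma> r)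
      - scale_field i_over_lambda (laurent (weyl_prod \<omega> r r)) =
      laurent (const_field (complexify \<omega>) + \<Omega> + K)"
    by (simp add: laurent_add laurent_diff)
  then show ?thesis
    by (simp add: fedosov_class_def r_def)
qed

definition one_over_i_lambda :: "complex fls" where
  "one_over_i_lambda = fls_const (1 / \<i>) * fls_X_inv"

lemma scale_one_over_i_lambda_laurent:
  "scale_field one_over_i_lambda (laurent (scale_field (fps_const \<i> * fps_X) a)) = laurent a"
proof -
  have "one_over_i_lambda * fps_to_fls (fps_const \<i> * fps_X) =
      (fls_const (1 / \<i>) * fls_const \<i>) * (fls_X_inv * fls_X)"
    by (simp only: one_over_i_lambda_def fls_times_fps_to_fls fps_const_to_fls fps_X_to_fls ac_simps)
  also have "\<dots> = 1"
    by (simp add: fls_X_inv_times_conv_shift)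
  finally show ?thesis
    by (simp add: fun_eq_iff scale_field_def laurent_def fls_times_fps_to_fls flip: mult.assoc)
qed

lemma characteristic_class_eq:
  assumes "smooth_atlas A"
    and "fedosov_element A \<omega> \<Gamma> (weyl_curvature \<omega> \<Gamma> + K) \<Omega> (star_r S)"
  shows "characteristic_class A \<omega> \<Gamma> S =
    de_rham_class_laurent A
      (scale_field one_over_i_lambda (laurent (const_field (complexify \<omega>) + \<Omega> + K)))"
  by (simp add: characteristic_class_def fedosov_class_eq[OF assms(2)] one_over_i_lambda_def
      H2_div_lambda_de_rham_class_laurent H2_scale_de_rham_class_laurent[OF assms(1)])

lemma characteristic_class_fedosov_star_product:
  assumes "smooth_atlas A" "fedosov_star_product A \<omega> \<Gamma> \<Omega> S"
  shows "characteristic_class A \<omega> \<Gamma> S =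
    de_rham_class_laurent A
      (scale_field one_over_i_lambda (laurent (const_field (complexify \<omega>) + \<Omega>)))"
proof -
  have "fedosov_element A \<omega> \<Gamma> (weyl_curvature \<omega> \<Gamma> + 0) \<Omega> (star_r S)"
    using assms(2) by (simp add: fedosov_star_product_def)
  from characteristic_class_eq[OF assms(1) this] show ?thesis
    by simp
qed

lemma characteristic_class_fedosov_End_product:
  assumes "smooth_atlas A" "fedosov_End_product A \<omega> \<Gamma> L \<alpha> \<Omega> S"
  shows "characteristic_class A \<omega> \<Gamma> S =
    de_rham_class_laurent A
      (scale_field one_over_i_lambda (laurent (const_field (complexify \<omega>) + \<Omega>))
        + - laurent (const_field (lb_curvature A L \<alpha>)))"
proof -
  define K where "K = - scale_field (fps_const \<i> * fps_X) (const_field (lb_curvature A L \<alpha>))"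
  have "fedosov_element A \<omega> \<Gamma> (weyl_curvature \<omega> \<Gamma> + K) \<Omega> (star_r S)"
    using assms(2) by (simp add: fedosov_End_product_def K_def)
  from characteristic_class_eq[OF assms(1) this] show ?thesis
    by (simp add: K_def laurent_diff tensor_field.scale_right_diff_distrib
        scale_one_over_i_lambda_laurent)
qed

lemma two_pi_i_chern_class:
  assumes "smooth_atlas A"
  shows "H2_scale (2 * of_real pi * \<i>) (H2_embed A (chern_class A L \<alpha>)) =
    de_rham_class_laurent A (- laurent (const_field (lb_curvature A L \<alpha>)))"
proof -
  define R where "R = lb_curvature A L \<alpha>"
  have "scale_field (fls_const (2 * of_real pi * \<i>))
      (laurent (const_field (scale_field (\<i> / (2 * of_real pi)) R))) =
      - laurent (const_field R)"
    by (simp add: fun_eq_iff scale_field_def laurent_def const_field_def)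
  then show ?thesis
    by (simp add: chern_class_def H2_embed_de_rham_class H2_scale_de_rham_class_laurent[OF assms]
        R_def)
qed

theorem corollary2:
  fixes A :: "('m::{t2_space, second_countable_topology}, 'n::finite) chart set"
    and \<omega> :: "('m, 'n, real) field"
    and \<Gamma> :: "('m, 'n) christoffel"
    and L :: "('l, 'm) line_bundle"
    and \<alpha> :: "('l, 'm, 'n) lb_conn"
    and \<Omega> :: "('m, 'n, complex fps) field"
    and star star' :: "('m, 'n) star_product"
  assumes "smooth_atlas A"
    and "symplectic_form A \<omega>"
    and "symplectic_connection A \<omega> \<Gamma>" and "torsion_free A \<Gamma>"
    and "complex_line_bundle A L" and "line_bundle_connection A L \<alpha>"
    and "closed_two_form_series A \<Omega>"
    and "fedosov_star_product A \<omega> \<Gamma> \<Omega> star"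
    and "fedosov_End_product A \<omega> \<Gamma> L \<alpha> \<Omega> star'"
  shows "characteristic_class A \<omega> \<Gamma> star' =
         characteristic_class A \<omega> \<Gamma> star +
         H2_scale (2 * of_real pi * \<i>) (H2_embed A (chern_class A L \<alpha>))"
proof -
  note atlas = \<open>smooth_atlas A\<close>
  let ?F = "scale_field one_over_i_lambda (laurent (const_field (complexify \<omega>) + \<Omega>))"
  let ?R = "laurent (const_field (lb_curvature A L \<alpha>))"
  have "characteristic_class A \<omega> \<Gamma> star' = de_rham_class_laurent A (?F + - ?R)"
    using \<open>fedosov_End_product A \<omega> \<Gamma> L \<alpha> \<Omega> star'\<close>
    by (rule characteristic_class_fedosov_End_product[OF atlas])
  also have "\<dots> = de_rham_class_laurent A ?F + de_rham_class_laurent A (- ?R)"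
    by (rule de_rham_class_laurent_add[OF atlas])
  also have "de_rham_class_laurent A ?F = characteristic_class A \<omega> \<Gamma> star"
    using \<open>fedosov_star_product A \<omega> \<Gamma> \<Omega> star\<close>
    by (rule characteristic_class_fedosov_star_product[OF atlas, symmetric])
  also have "de_rham_class_laurent A (- ?R) =
      H2_scale (2 * of_real pi * \<i>) (H2_embed A (chern_class A L \<alpha>))"
    by (rule two_pi_i_chern_class[OF atlas, symmetric])
  finally show ?thesis .
qed

end
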